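(* Let $L$, $V$ be finitely generated abelian groups and let $\varphi\colon L\times L\to V$ be a skew-symmetric bilinear map. Let $L_{\mathbb{Q}}=\mathbb{Q}\otimes L$, $V_{\mathbb{Q}}=\mathbb{Q}\otimes V$, and let $$\varphi_{\mathbb{Q}}\colon L_{\mathbb{Q}}\times L_{\mathbb{Q}}\to V_{\mathbb{Q}},\quad \varphi_{\mathbb{Q}}(q_1\otimes x_1,q_2\otimes x_2)=q_1q_2\otimes\varphi(x_1,x_2)$$ be the induced skew-symmetric bilinear map. Then (i) for every maximal isotropic subgroup $H\subseteq L$, the subspace $H_{\mathbb{Q}}=\mathbb{Q}\otimes H\subseteq L_{\mathbb{Q}}$ is maximal isotropic; (ii) for every maximal isotropic subspace $H_{\mathbb{Q}}\subseteq L_{\mathbb{Q}}$, there is a maximal isotropic subgroup $H\subseteq L$ such that $H_{\mathbb{Q}}=\mathbb{Q}\otimes H$. In particular, $\mathcal{H}(\varphi)=\mathcal{H}(\varphi_{\mathbb{Q}})$ and $h(\varphi)=h(\varphi_{\mathbb{Q}})$.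
   Context: A subgroup of $L$ (respectively, a subspace of $L_{\mathbb{Q}}$) is isotropic under $\varphi$ (respectively, $\varphi_{\mathbb{Q}}$) if the bilinear map vanishes on all pairs of its elements; it is maximal isotropic if it is isotropic and not properly contained in another isotropic subgroup (subspace). $\mathcal{H}(\varphi)$ is the set of ranks of all maximal isotropic subgroups of $L$, $\mathcal{H}(\varphi_{\mathbb{Q}})$ is the set of dimensions of all maximal isotropic subspaces of $L_{\mathbb{Q}}$; $h(\varphi)=\max\mathcal{H}(\varphi)$ and $h(\varphi_{\mathbb{Q}})=\max\mathcal{H}(\varphi_{\mathbb{Q}})$. Skew-symmetric means $\varphi(x,y)=-\varphi(y,x)$ for all $x,y$. *)

theory Defs
  imports Complex_Main "HOL-Library.Poly_Mapping" "HOL-Computational_Algebra.Group_Closure"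
begin

definition int_scale :: "int \<Rightarrow> 'a::ab_group_add \<Rightarrow> 'a"
  where "int_scale k x = (\<Sum>i<nat k. x) - (\<Sum>i<nat (- k). x)"

lemma sum_const_add: "(\<Sum>i<m + (n::nat). x) = (\<Sum>i<m. x) + (\<Sum>i<n. (x::'a::ab_group_add))"
  by (induction n) (simp_all add: algebra_simps)

lemma int_scale_diff_nat:
  "int_scale (int m - int n) x = (\<Sum>i<m. x) - (\<Sum>i<n. (x::'a::ab_group_add))"
proof (cases "n \<le> m")
  case True
  then obtain d where "m = n + d" using le_Suc_ex by blast
  then show ?thesis by (simp add: int_scale_def sum_const_add)
next
  case False
  then obtain d where "n = m + d" using le_Suc_ex nat_le_linear by blast
  then show ?thesis by (simp add: int_scale_def sum_const_add)
qed

lemma int_scale_0 [simp]: "int_scale 0 x = 0"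
  and int_scale_1 [simp]: "int_scale 1 x = x"
  and int_scale_zero_right [simp]: "int_scale k 0 = 0"
  by (simp_all add: int_scale_def)

lemma int_scale_add_left: "int_scale (a + b) x = int_scale a x + int_scale b x"
proof -
  obtain m n where a: "a = int m - int n" using int_diff_cases by blast
  obtain p q where b: "b = int p - int q" using int_diff_cases by blast
  have "a + b = int (m + p) - int (n + q)" by (simp add: a b)
  then show ?thesis
    unfolding a b by (simp only: int_scale_diff_nat sum_const_add) (simp add: algebra_simps)
qed

lemma int_scale_add_right: "int_scale a (x + y) = int_scale a x + int_scale a y"
  by (simp add: int_scale_def sum.distrib algebra_simps)

lemma int_scale_minus_left: "int_scale (- a) x = - int_scale a x"
  by (simp add: int_scale_def)

lemma int_scale_assoc: "int_scale a (int_scale b x) = int_scale (a * b) x"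
proof (induction a rule: int_induct[where k = 0])
  case base
  then show ?case by simp
next
  case (step1 i)
  then show ?case by (simp add: int_scale_add_left distrib_right)
next
  case (step2 i)
  have "int_scale (i - 1) (int_scale b x) = int_scale i (int_scale b x) - int_scale b x"
    using int_scale_add_left[of i "- 1"] by (simp add: int_scale_minus_left)
  moreover have "int_scale ((i - 1) * b) x = int_scale (i * b) x - int_scale b x"
    using int_scale_add_left[of "i * b" "- b" x] by (simp add: int_scale_minus_left left_diff_distrib)
  ultimately show ?case using step2 by simp
qed

global_interpretation int_module: module int_scale
  by unfold_locales (simp_all add: int_scale_add_left int_scale_add_right int_scale_assoc)

definition is_subgroup :: "'a::ab_group_add set \<Rightarrow> bool"
  where "is_subgroup H \<longleftrightarrow> 0 \<in> H \<and> (\<forall>x\<in>H. \<forall>y\<in>H. x + y \<in> H) \<and> (\<forall>x\<in>H. - x \<in> H)"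

definition finitely_generated :: "'a::ab_group_add set \<Rightarrow> bool"
  where "finitely_generated H \<longleftrightarrow> (\<exists>S. finite S \<and> group_closure S = H)"

text \<open>Torsion-free rank. The maximum exists for every subgroup of a finitely generated group;
  otherwise the value is unspecified.\<close>

definition group_rank :: "'a::ab_group_add set \<Rightarrow> nat"
  where "group_rank H = Max {card B |B. finite B \<and> B \<subseteq> H \<and> int_module.independent B}"

definition biadditive :: "('a::ab_group_add \<Rightarrow> 'b::ab_group_add \<Rightarrow> 'c::ab_group_add) \<Rightarrow> bool"
  where "biadditive f \<longleftrightarrow>
    (\<forall>x y z. f (x + y) z = f x z + f y z) \<and> (\<forall>x y z. f x (y + z) = f x y + f x z)"

definition skew_symmetric :: "('a \<Rightarrow> 'a \<Rightarrow> 'b::ab_group_add) \<Rightarrow> bool"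
  where "skew_symmetric f \<longleftrightarrow> (\<forall>x y. f x y = - f y x)"


text \<open>The quotient of the free abelian group on \<open>'a \<times> 'b\<close> by the subgroup generated by
  the bilinearity relations.\<close>

definition tensor_relators :: "(('a::ab_group_add \<times> 'b::ab_group_add) \<Rightarrow>\<^sub>0 int) set"
  where "tensor_relators =
    {frag_of (x + y, z) - frag_of (x, z) - frag_of (y, z) |x y z. True} \<union>
    {frag_of (x, y + z) - frag_of (x, y) - frag_of (x, z) |x y z. True}"

definition tensor_eq ::
    "(('a::ab_group_add \<times> 'b::ab_group_add) \<Rightarrow>\<^sub>0 int) \<Rightarrow> ('a \<times> 'b \<Rightarrow>\<^sub>0 int) \<Rightarrow> bool"
  where "tensor_eq u v \<longleftrightarrow> u - v \<in> group_closure tensor_relators"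

lemma tensor_eq_refl: "tensor_eq u u"
  by (simp add: tensor_eq_def)

lemma tensor_eq_sym: "tensor_eq u v \<Longrightarrow> tensor_eq v u"
  using group_closure_minus_iff[of "u - v" tensor_relators] by (simp add: tensor_eq_def)

lemma tensor_eq_trans: "tensor_eq u v \<Longrightarrow> tensor_eq v w \<Longrightarrow> tensor_eq u w"
  using group_closure_add[of "u - v" tensor_relators "v - w"] by (simp add: tensor_eq_def)

lemma tensor_eq_equivp: "equivp tensor_eq"
  by (intro equivpI reflpI sympI transpI)
    (rule tensor_eq_refl, erule tensor_eq_sym, erule (1) tensor_eq_trans)

quotient_type (overloaded) ('a, 'b) tensor =
    "('a::ab_group_add \<times> 'b::ab_group_add) \<Rightarrow>\<^sub>0 int" / tensor_eq
  by (rule tensor_eq_equivp)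

lemma tensor_eq_add: "tensor_eq u v \<Longrightarrow> tensor_eq u' v' \<Longrightarrow> tensor_eq (u + u') (v + v')"
  using group_closure_add[of "u - v" tensor_relators "u' - v'"]
  by (simp add: tensor_eq_def add_diff_add)

lemma tensor_eq_minus: "tensor_eq u v \<Longrightarrow> tensor_eq (- u) (- v)"
  using group_closure_minus_iff[of "u - v" tensor_relators] by (simp add: tensor_eq_def)

lemma tensor_eq_diff: "tensor_eq u v \<Longrightarrow> tensor_eq u' v' \<Longrightarrow> tensor_eq (u - u') (v - v')"
  using tensor_eq_add[of u v "- u'" "- v'"] tensor_eq_minus[of u' v'] by simp

instantiation tensor :: (ab_group_add, ab_group_add) ab_group_add
begin

lift_definition zero_tensor :: "('a, 'b) tensor" is 0 .

lift_definition plus_tensor :: "('a, 'b) tensor \<Rightarrow> ('a, 'b) tensor \<Rightarrow> ('a, 'b) tensor"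
  is "(+)" by (rule tensor_eq_add)

lift_definition uminus_tensor :: "('a, 'b) tensor \<Rightarrow> ('a, 'b) tensor"
  is uminus by (rule tensor_eq_minus)

lift_definition minus_tensor :: "('a, 'b) tensor \<Rightarrow> ('a, 'b) tensor \<Rightarrow> ('a, 'b) tensor"
  is "(-)" by (rule tensor_eq_diff)

instance
proof
  fix a b c :: "('a, 'b) tensor"
  show "a + b + c = a + (b + c)" by transfer (simp add: tensor_eq_refl add.assoc)
  show "a + b = b + a" by transfer (simp add: tensor_eq_refl add.commute)
  show "0 + a = a" by transfer (simp add: tensor_eq_refl)
  show "- a + a = 0" by transfer (simp add: tensor_eq_refl)
  show "a - b = a + - b" by transfer (simp add: tensor_eq_refl)
qed

end

lift_definition pure_tensor :: "'a::ab_group_add \<Rightarrow> 'b::ab_group_add \<Rightarrow> ('a, 'b) tensor"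
    (infixr \<open>\<otimes>\<^sub>\<int>\<close> 75)
  is "\<lambda>a b. frag_of (a, b)" .

lemma pure_tensor_add_left: "(x + y) \<otimes>\<^sub>\<int> z = x \<otimes>\<^sub>\<int> z + y \<otimes>\<^sub>\<int> z"
  by transfer
    (unfold tensor_eq_def diff_diff_eq[symmetric],
      rule group_closure.base, unfold tensor_relators_def, blast)

lemma pure_tensor_add_right: "x \<otimes>\<^sub>\<int> (y + z) = x \<otimes>\<^sub>\<int> y + x \<otimes>\<^sub>\<int> z"
  by transfer
    (unfold tensor_eq_def diff_diff_eq[symmetric],
      rule group_closure.base, unfold tensor_relators_def, blast)

lemma biadditive_pure_tensor: "biadditive (\<otimes>\<^sub>\<int>)"
  by (simp add: biadditive_def pure_tensor_add_left pure_tensor_add_right)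

lemma tensor_induct [case_names zero pure diff]:
  assumes "P 0" "\<And>x y. P (x \<otimes>\<^sub>\<int> y)" "\<And>s t. P s \<Longrightarrow> P t \<Longrightarrow> P (s - t)"
  shows "P t"
proof -
  have "P (abs_tensor c)" for c
    using subset_UNIV[of "Poly_Mapping.keys c"]
  proof (induction c rule: frag_induction)
    case zero
    then show ?case using assms(1) by (simp add: zero_tensor_def)
  next
    case (one p)
    then show ?case using assms(2)[of "fst p" "snd p"] by (simp add: pure_tensor.abs_eq)
  next
    case (diff a b)
    then show ?case using assms(3) by (simp add: minus_tensor.abs_eq[symmetric])
  qed
  from this[of "rep_tensor t"] show ?thesis
    by (simp add: Quotient3_abs_rep[OF Quotient3_tensor])
qed

definition free_lift :: "('b \<Rightarrow> 'c::ab_group_add) \<Rightarrow> ('b \<Rightarrow>\<^sub>0 int) \<Rightarrow> 'c"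
  where "free_lift f u = (\<Sum>i\<in>Poly_Mapping.keys u. int_scale (Poly_Mapping.lookup u i) (f i))"

lemma free_lift_superset:
  assumes "finite A" "Poly_Mapping.keys u \<subseteq> A"
  shows "free_lift f u = (\<Sum>i\<in>A. int_scale (Poly_Mapping.lookup u i) (f i))"
  unfolding free_lift_def using assms
  by (intro sum.mono_neutral_left) (auto simp: in_keys_iff)

lemma free_lift_of [simp]: "free_lift f (frag_of i) = f i"
  by (simp add: free_lift_def)

lemma free_lift_diff: "free_lift f (u - v) = free_lift f u - free_lift f v"
proof -
  let ?A = "Poly_Mapping.keys u \<union> Poly_Mapping.keys v"
  have "free_lift f (u - v) = (\<Sum>i\<in>?A. int_scale (Poly_Mapping.lookup (u - v) i) (f i))"
    by (intro free_lift_superset) (auto simp: keys_diff)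
  also have "\<dots> = (\<Sum>i\<in>?A. int_scale (Poly_Mapping.lookup u i) (f i))
      - (\<Sum>i\<in>?A. int_scale (Poly_Mapping.lookup v i) (f i))"
    by (simp add: lookup_minus int_module.scale_left_diff_distrib sum_subtractf)
  also have "\<dots> = free_lift f u - free_lift f v"
    by (simp add: free_lift_superset[of ?A])
  finally show ?thesis .
qed

text \<open>The homomorphism on the tensor product induced by \<open>f\<close>, independent of the chosen
  representative when \<open>f\<close> is biadditive.\<close>

definition tensor_lift ::
    "('a::ab_group_add \<Rightarrow> 'b::ab_group_add \<Rightarrow> 'c::ab_group_add) \<Rightarrow> ('a, 'b) tensor \<Rightarrow> 'c"
  where "tensor_lift f t = free_lift (case_prod f) (rep_tensor t)"

lemma tensor_lift_abs:
  assumes "biadditive f"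
  shows "tensor_lift f (abs_tensor u) = free_lift (case_prod f) u"
proof -
  have "free_lift (case_prod f) w = 0" if "w \<in> group_closure tensor_relators" for w
    using that
  proof induction
    case (base s)
    then show ?case using assms
      by (auto simp: tensor_relators_def biadditive_def free_lift_diff free_lift_def[of _ 0])
  next
    case (diff s t)
    then show ?case by (simp add: free_lift_diff)
  qed
  moreover have "tensor_eq (rep_tensor (abs_tensor u)) u"
    by (rule Quotient3_rep_abs[OF Quotient3_tensor tensor_eq_refl])
  ultimately have "free_lift (case_prod f) (rep_tensor (abs_tensor u) - u) = 0"
    by (simp add: tensor_eq_def)
  then show ?thesis
    by (simp add: tensor_lift_def free_lift_diff)
qed

lemma tensor_lift_pure [simp]:
  assumes "biadditive f"
  shows "tensor_lift f (x \<otimes>\<^sub>\<int> y) = f x y"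
  by (simp add: pure_tensor.abs_eq tensor_lift_abs[OF assms])

lemma tensor_lift_diff:
  assumes "biadditive f"
  shows "tensor_lift f (s - t) = tensor_lift f s - tensor_lift f t"
proof -
  obtain u v where "s = abs_tensor u" "t = abs_tensor v"
    by (metis Quotient3_abs_rep[OF Quotient3_tensor])
  then show ?thesis by (simp add: minus_tensor.abs_eq tensor_lift_abs[OF assms] free_lift_diff)
qed

lemma tensor_lift_zero:
  assumes "biadditive f"
  shows "tensor_lift f 0 = 0"
  using tensor_lift_diff[OF assms, of 0 0] by simp

lemma tensor_lift_add:
  assumes "biadditive f"
  shows "tensor_lift f (s + t) = tensor_lift f s + tensor_lift f t"
  using tensor_lift_diff[OF assms, of "s + t" t] by (simp add: algebra_simps)

definition rat_scale :: "rat \<Rightarrow> (rat, 'a::ab_group_add) tensor \<Rightarrow> (rat, 'a) tensor"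
  where "rat_scale q = tensor_lift (\<lambda>p x. (q * p) \<otimes>\<^sub>\<int> x)"

lemma biadditive_rat_scale: "biadditive (\<lambda>p x. ((q::rat) * p) \<otimes>\<^sub>\<int> x)"
  by (simp add: biadditive_def pure_tensor_add_left pure_tensor_add_right distrib_left)

lemma rat_scale_pure [simp]: "rat_scale q (p \<otimes>\<^sub>\<int> x) = (q * p) \<otimes>\<^sub>\<int> x"
  by (simp add: rat_scale_def biadditive_rat_scale)

lemma rat_scale_diff: "rat_scale q (s - t) = rat_scale q s - rat_scale q t"
  by (simp add: rat_scale_def tensor_lift_diff biadditive_rat_scale)

lemma rat_scale_zero [simp]: "rat_scale q 0 = 0"
  by (simp add: rat_scale_def tensor_lift_zero biadditive_rat_scale)

global_interpretation rat_space: vector_space rat_scale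
proof
  fix a b :: rat and s t :: "(rat, 'a) tensor"
  show "rat_scale a (s + t) = rat_scale a s + rat_scale a t"
    by (simp add: rat_scale_def tensor_lift_add biadditive_rat_scale)
  show "rat_scale (a + b) s = rat_scale a s + rat_scale b s"
    by (induction s rule: tensor_induct)
      (simp_all add: rat_scale_diff distrib_right pure_tensor_add_left algebra_simps)
  show "rat_scale a (rat_scale b s) = rat_scale (a * b) s"
    by (induction s rule: tensor_induct) (simp_all add: rat_scale_diff mult.assoc)
  show "rat_scale 1 s = s"
    by (induction s rule: tensor_induct) (simp_all add: rat_scale_diff)
qed

text \<open>The image in \<open>\<rat> \<otimes> L\<close> of the map \<open>\<rat> \<otimes> H \<rightarrow> \<rat> \<otimes> L\<close> induced by the
  inclusion of a subgroup \<open>H\<close>; this map is injective since \<open>\<rat>\<close> is flat.\<close>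

definition rat_extension :: "'a::ab_group_add set \<Rightarrow> (rat, 'a) tensor set"
  where "rat_extension H = group_closure {q \<otimes>\<^sub>\<int> x |q x. x \<in> H}"

definition rat_form ::
    "('a::ab_group_add \<Rightarrow> 'a \<Rightarrow> 'b::ab_group_add) \<Rightarrow>
      (rat, 'a) tensor \<Rightarrow> (rat, 'a) tensor \<Rightarrow> (rat, 'b) tensor"
  where "rat_form \<phi> s t =
    tensor_lift (\<lambda>p x. tensor_lift (\<lambda>q y. (p * q) \<otimes>\<^sub>\<int> \<phi> x y) t) s"

lemma biadditive_rat_form_inner:
  assumes "biadditive \<phi>"
  shows "biadditive (\<lambda>q y. ((p::rat) * q) \<otimes>\<^sub>\<int> \<phi> x y)"
  using assms
  by (simp add: biadditive_def pure_tensor_add_left pure_tensor_add_right distrib_left)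

lemma biadditive_diff:
  assumes "biadditive f" "biadditive g"
  shows "biadditive (\<lambda>x y. f x y - g x y)"
  using assms by (simp add: biadditive_def algebra_simps)

lemma biadditive_rat_form_outer:
  assumes "biadditive \<phi>"
  shows "biadditive (\<lambda>p x. tensor_lift (\<lambda>q y. ((p::rat) * q) \<otimes>\<^sub>\<int> \<phi> x y) t)"
proof (induction t rule: tensor_induct)
  case zero
  then show ?case
    by (simp add: biadditive_def tensor_lift_zero[OF biadditive_rat_form_inner[OF assms]])
next
  case (pure q y)
  have "tensor_lift (\<lambda>q y. ((p::rat) * q) \<otimes>\<^sub>\<int> \<phi> x y) (q \<otimes>\<^sub>\<int> y) = (p * q) \<otimes>\<^sub>\<int> \<phi> x y" for p x
    by (rule tensor_lift_pure[OF biadditive_rat_form_inner[OF assms]])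
  then show ?case using assms
    by (simp add: biadditive_def pure_tensor_add_left pure_tensor_add_right distrib_right)
next
  case (diff s t)
  have "tensor_lift (\<lambda>q y. ((p::rat) * q) \<otimes>\<^sub>\<int> \<phi> x y) (s - t) =
      tensor_lift (\<lambda>q y. (p * q) \<otimes>\<^sub>\<int> \<phi> x y) s - tensor_lift (\<lambda>q y. (p * q) \<otimes>\<^sub>\<int> \<phi> x y) t"
    for p x
    by (rule tensor_lift_diff[OF biadditive_rat_form_inner[OF assms]])
  then show ?case using biadditive_diff[OF diff] by simp
qed

lemma rat_form_pure_left:
  assumes "biadditive \<phi>"
  shows "rat_form \<phi> (p \<otimes>\<^sub>\<int> x) t = tensor_lift (\<lambda>q y. (p * q) \<otimes>\<^sub>\<int> \<phi> x y) t"
  unfolding rat_form_def by (rule tensor_lift_pure[OF biadditive_rat_form_outer[OF assms]])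

lemma rat_form_pure:
  assumes "biadditive \<phi>"
  shows "rat_form \<phi> (p \<otimes>\<^sub>\<int> x) (q \<otimes>\<^sub>\<int> y) = (p * q) \<otimes>\<^sub>\<int> \<phi> x y"
  unfolding rat_form_pure_left[OF assms]
  by (rule tensor_lift_pure[OF biadditive_rat_form_inner[OF assms]])

lemma rat_form_diff_left:
  assumes "biadditive \<phi>"
  shows "rat_form \<phi> (r - s) t = rat_form \<phi> r t - rat_form \<phi> s t"
  unfolding rat_form_def by (rule tensor_lift_diff[OF biadditive_rat_form_outer[OF assms]])

lemma rat_form_zero_left:
  assumes "biadditive \<phi>"
  shows "rat_form \<phi> 0 t = 0"
  unfolding rat_form_def by (rule tensor_lift_zero[OF biadditive_rat_form_outer[OF assms]])

lemma rat_form_diff_right: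
  assumes "biadditive \<phi>"
  shows "rat_form \<phi> r (s - t) = rat_form \<phi> r s - rat_form \<phi> r t"
proof (induction r rule: tensor_induct)
  case (pure p x)
  show ?case unfolding rat_form_pure_left[OF assms]
    by (rule tensor_lift_diff[OF biadditive_rat_form_inner[OF assms]])
qed (simp_all add: rat_form_zero_left[OF assms] rat_form_diff_left[OF assms])

lemma rat_form_zero_right:
  assumes "biadditive \<phi>"
  shows "rat_form \<phi> r 0 = 0"
  using rat_form_diff_right[OF assms, of r 0 0] by simp

lemma rat_form_biadditive:
  assumes "biadditive \<phi>"
  shows "biadditive (rat_form \<phi>)"
proof -
  have "rat_form \<phi> (r + s) t = rat_form \<phi> r t + rat_form \<phi> s t" for r s t
    using rat_form_diff_left[OF assms, of "r + s" s t] by (simp add: algebra_simps)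
  moreover have "rat_form \<phi> r (s + t) = rat_form \<phi> r s + rat_form \<phi> r t" for r s t
    using rat_form_diff_right[OF assms, of r "s + t" t] by (simp add: algebra_simps)
  ultimately show ?thesis by (simp add: biadditive_def)
qed

lemma rat_form_scale:
  assumes "biadditive \<phi>"
  shows "rat_form \<phi> (rat_scale c s) t = rat_scale c (rat_form \<phi> s t)"
    and "rat_form \<phi> s (rat_scale c t) = rat_scale c (rat_form \<phi> s t)"
proof -
  note simps = rat_form_pure[OF assms] rat_form_zero_left[OF assms] rat_form_zero_right[OF assms]
    rat_form_diff_left[OF assms] rat_form_diff_right[OF assms] rat_scale_diff
  have "rat_form \<phi> (rat_scale c (p \<otimes>\<^sub>\<int> x)) t = rat_scale c (rat_form \<phi> (p \<otimes>\<^sub>\<int> x) t)" for p x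
    by (induction t rule: tensor_induct) (simp_all add: simps mult.assoc)
  then show "rat_form \<phi> (rat_scale c s) t = rat_scale c (rat_form \<phi> s t)"
    by (induction s rule: tensor_induct) (simp_all add: simps del: rat_scale_pure)
  have "rat_form \<phi> (p \<otimes>\<^sub>\<int> x) (rat_scale c t) = rat_scale c (rat_form \<phi> (p \<otimes>\<^sub>\<int> x) t)" for p x
    by (induction t rule: tensor_induct) (simp_all add: simps mult.left_commute)
  then show "rat_form \<phi> s (rat_scale c t) = rat_scale c (rat_form \<phi> s t)"
    by (induction s rule: tensor_induct) (simp_all add: simps)
qed

lemma pure_tensor_minus_right: "x \<otimes>\<^sub>\<int> (- y) = - (x \<otimes>\<^sub>\<int> y)"
proof -
  have "x \<otimes>\<^sub>\<int> (0 :: 'b) = (0 :: ('a, 'b) tensor)"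
    using pure_tensor_add_right[of x 0 "0 :: 'b"] by simp
  then show ?thesis
    using pure_tensor_add_right[of x y "- y"] by (simp add: eq_neg_iff_add_eq_0 add.commute)
qed

lemma rat_form_skew_symmetric:
  assumes "biadditive \<phi>" "skew_symmetric \<phi>"
  shows "skew_symmetric (rat_form \<phi>)"
proof -
  note simps = rat_form_pure[OF assms(1)] rat_form_zero_left[OF assms(1)]
    rat_form_zero_right[OF assms(1)] rat_form_diff_left[OF assms(1)]
    rat_form_diff_right[OF assms(1)]
  have swap_pure: "rat_form \<phi> (p \<otimes>\<^sub>\<int> x) (q \<otimes>\<^sub>\<int> y) = - rat_form \<phi> (q \<otimes>\<^sub>\<int> y) (p \<otimes>\<^sub>\<int> x)" for p x q y
  proof -
    have "(p * q) \<otimes>\<^sub>\<int> \<phi> x y = (q * p) \<otimes>\<^sub>\<int> (- \<phi> y x)"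
      using assms(2) unfolding skew_symmetric_def by (metis mult.commute)
    then show ?thesis by (simp only: rat_form_pure[OF assms(1)] pure_tensor_minus_right)
  qed
  have swap_left: "rat_form \<phi> (p \<otimes>\<^sub>\<int> x) t = - rat_form \<phi> t (p \<otimes>\<^sub>\<int> x)" for p x t
  proof (induction t rule: tensor_induct)
    case zero
    show ?case by (simp only: simps minus_zero)
  next
    case (pure q y)
    show ?case by (rule swap_pure)
  next
    case (diff s t)
    then show ?case by (simp only: simps minus_diff_minus)
  qed
  have "rat_form \<phi> s t = - rat_form \<phi> t s" for s t
  proof (induction s rule: tensor_induct)
    case zero
    show ?case by (simp only: simps minus_zero)
  next
    case (pure p x)
    show ?case by (rule swap_left)
  next
    case (diff r s)
    then show ?case by (simp only: simps minus_diff_minus)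
  qed
  then show ?thesis unfolding skew_symmetric_def by blast
qed

definition isotropic :: "('a \<Rightarrow> 'a \<Rightarrow> 'b::zero) \<Rightarrow> 'a set \<Rightarrow> bool"
  where "isotropic \<phi> H \<longleftrightarrow> (\<forall>x\<in>H. \<forall>y\<in>H. \<phi> x y = 0)"

definition max_isotropic_subgroup ::
    "('a::ab_group_add \<Rightarrow> 'a \<Rightarrow> 'b::ab_group_add) \<Rightarrow> 'a set \<Rightarrow> bool"
  where "max_isotropic_subgroup \<phi> H \<longleftrightarrow>
    is_subgroup H \<and> isotropic \<phi> H \<and>
    \<not> (\<exists>K. is_subgroup K \<and> isotropic \<phi> K \<and> H \<subset> K)"

definition max_isotropic_subspace ::
    "((rat, 'a::ab_group_add) tensor \<Rightarrow> (rat, 'a) tensor \<Rightarrow> (rat, 'b::ab_group_add) tensor) \<Rightarrow>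
      (rat, 'a) tensor set \<Rightarrow> bool"
  where "max_isotropic_subspace \<psi> W \<longleftrightarrow>
    rat_space.subspace W \<and> isotropic \<psi> W \<and>
    \<not> (\<exists>U. rat_space.subspace U \<and> isotropic \<psi> U \<and> W \<subset> U)"

definition isotropic_ranks :: "('a::ab_group_add \<Rightarrow> 'a \<Rightarrow> 'b::ab_group_add) \<Rightarrow> nat set"
  where "isotropic_ranks \<phi> = {group_rank H |H. max_isotropic_subgroup \<phi> H}"

definition isotropic_dims ::
    "((rat, 'a::ab_group_add) tensor \<Rightarrow> (rat, 'a) tensor \<Rightarrow> (rat, 'b::ab_group_add) tensor) \<Rightarrow>
      nat set"
  where "isotropic_dims \<psi> = {rat_space.dim W |W. max_isotropic_subspace \<psi> W}"

definition max_isotropic_rank :: "('a::ab_group_add \<Rightarrow> 'a \<Rightarrow> 'b::ab_group_add) \<Rightarrow> nat"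
  where "max_isotropic_rank \<phi> = Max (isotropic_ranks \<phi>)"

definition max_isotropic_dim ::
    "((rat, 'a::ab_group_add) tensor \<Rightarrow> (rat, 'a) tensor \<Rightarrow> (rat, 'b::ab_group_add) tensor) \<Rightarrow> nat"
  where "max_isotropic_dim \<psi> = Max (isotropic_dims \<psi>)"

end

theory Submission
  imports Defs
begin

text \<open>
  Write \<open>1 \<otimes> x\<close> for the image of \<open>x\<close> in \<open>\<rat> \<otimes> L\<close>. The proof rests on three facts.

  First, \<open>1 \<otimes> x = 0\<close> holds only for torsion elements \<open>x\<close>
  (\<open>torsion_if_pure_tensor_eq_zero\<close>), and every element of \<open>\<rat> \<otimes> L\<close> has a nonzero
  integer multiple of the form \<open>1 \<otimes> x\<close> (\<open>integral_multiple\<close>). So isotropy over \<open>\<rat>\<close>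
  means that the values of \<open>\<phi>\<close> are torsion, rather than zero.

  Secondly, the torsion of \<open>V\<close> is killed by a single integer \<open>N > 0\<close>
  (\<open>torsion_exponent\<close>), because some positive multiple of \<open>V\<close> lies in a free subgroup. Hence
  replacing \<open>x\<close> by \<open>N x\<close> turns a torsion value of \<open>\<phi>\<close> into an honest zero, and does not
  change the rational line through \<open>1 \<otimes> x\<close>. For (i), if \<open>H\<close> is maximal and a vector
  \<open>1 \<otimes> x\<close> can be added to the subspace generated by \<open>H\<close>, then \<open>N x\<close> can be added to \<open>H\<close>,
  so \<open>N x \<in> H\<close> and nothing new was added. For (ii), the elements \<open>N x\<close> with
  \<open>1 \<otimes> x \<in> W\<close> generate an isotropic subgroup. Any maximal isotropic subgroup above it,
  which exists by Zorn's lemma, generates an isotropic subspace containing \<open>W\<close>, hence \<open>W\<close>.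

  Thirdly, a finite set is independent in \<open>L\<close> over the integers if and only if \<open>x \<mapsto> 1 \<otimes> x\<close>
  is injective on it with an image that is independent over the rationals, so that the rank of a subgroup is
  the dimension of its extension (\<open>group_rank_eq_dim\<close>). The equalities of ranks and dimensions
  then follow from (i) and (ii).
\<close>

section \<open>Integer multiples and generated subgroups\<close>

lemma additive_int_scale:
  assumes "additive g"
  shows "g (int_scale k x) = int_scale k (g x)"
  using assms by (simp add: int_scale_def additive.diff additive.sum)

lemma biadditive_additive:
  assumes "biadditive f"
  shows "additive (\<lambda>x. f x y)" and "additive (f x)"
  using assms by (auto simp: biadditive_def additive_def)

lemma biadditive_int_scale:
  assumes "biadditive f"
  shows "f (int_scale k x) y = int_scale k (f x y)"
    and "f x (int_scale k y) = int_scale k (f x y)"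
  using additive_int_scale[OF biadditive_additive(1)[OF assms]]
    additive_int_scale[OF biadditive_additive(2)[OF assms]] by auto

lemma int_scale_rat: "int_scale k (q :: rat) = of_int k * q"
  by (cases "k \<ge> 0") (simp_all add: int_scale_def)

lemma pure_tensor_int_scale_right: "q \<otimes>\<^sub>\<int> int_scale k x = (of_int k * q) \<otimes>\<^sub>\<int> x" for q :: rat
  using biadditive_int_scale(2)[OF biadditive_pure_tensor, of q k x]
    biadditive_int_scale(1)[OF biadditive_pure_tensor, of k q x]
  by (simp add: int_scale_rat)

lemma pure_tensor_zero_right [simp]: "q \<otimes>\<^sub>\<int> 0 = 0"
  using additive.zero[OF biadditive_additive(2)[OF biadditive_pure_tensor]] .

lemma pure_tensor_zero_left [simp]: "0 \<otimes>\<^sub>\<int> x = 0"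
  using additive.zero[OF biadditive_additive(1)[OF biadditive_pure_tensor]] .

lemma is_subgroup_group_closure: "is_subgroup (group_closure S)"
  by (simp add: is_subgroup_def group_closure_add)

lemma group_closure_superset: "S \<subseteq> group_closure S"
  by (auto intro: group_closure.base)

text \<open>Both for subgroups of \<open>L\<close> and for subspaces of \<open>\<rat> \<otimes> L\<close>, isotropy need only be
  tested on generators.\<close>

lemma isotropic_group_closure:
  assumes f: "biadditive f" and S: "isotropic f S"
  shows "isotropic f (group_closure S)"
proof -
  note simps = additive.diff[OF biadditive_additive(1)[OF f]]
    additive.diff[OF biadditive_additive(2)[OF f]]
    additive.zero[OF biadditive_additive(1)[OF f]]
    additive.zero[OF biadditive_additive(2)[OF f]]
  have *: "f x y = 0" if "x \<in> S" "y \<in> group_closure S" for x y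
    using that(2) by induction (use that(1) S in \<open>auto simp: simps isotropic_def\<close>)
  have "f x y = 0" if "x \<in> group_closure S" "y \<in> group_closure S" for x y
    using that(1) by induction (use that(2) * in \<open>auto simp: simps\<close>)
  then show ?thesis by (simp add: isotropic_def)
qed

section \<open>Torsion and denominators\<close>

text \<open>Used with \<open>P i d\<close> saying that \<open>d\<close> clears the denominator of the \<open>i\<close>-th rational number, or
  that \<open>d\<close> moves the \<open>i\<close>-th generator into a fixed subgroup.\<close>

lemma int_common_multiple:
  fixes P :: "'i \<Rightarrow> int \<Rightarrow> bool"
  assumes "finite A"
    and "\<And>i. i \<in> A \<Longrightarrow> \<exists>d>0. P i d"
    and mult: "\<And>i c d. P i d \<Longrightarrow> P i (c * d)"
  shows "\<exists>D>0. \<forall>i\<in>A. P i D"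
  using assms(1,2)
proof (induction A)
  case empty
  show ?case by (auto intro: exI[of _ 1])
next
  case (insert i A)
  obtain D where D: "D > 0" "\<forall>j\<in>A. P j D" using insert by auto
  obtain d where d: "d > 0" "P i d" using insert.prems by auto
  have "P j (D * d)" if "j \<in> insert i A" for j
    using that d(2) D(2) mult[of i d D] mult[of j D d] by (auto simp: mult.commute)
  then show ?case using D(1) d(1) by (intro exI[of _ "D * d"]) auto
qed

lemma rat_denominator: "\<exists>d>0. of_int d * (q :: rat) \<in> \<int>"
proof (cases q)
  case (Fract a b)
  then have "of_int b * q = of_int a" by (simp add: Fract_of_int_quotient)
  then show ?thesis using Fract(2) by (metis Ints_of_int)
qed

lemma rat_common_denominator:
  assumes "finite A"
  obtains d :: int where "d > 0" "\<And>i. i \<in> A \<Longrightarrow> of_int d * (q i :: rat) \<in> \<int>"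
proof -
  have "\<exists>D>0. \<forall>i\<in>A. of_int D * q i \<in> \<int>"
    by (rule int_common_multiple[OF assms rat_denominator]) (simp add: mult.assoc)
  then show ?thesis using that by auto
qed

text \<open>A given combination of bilinearity relators involves only finitely many denominators. If \<open>M\<close>
  is a multiple of all of them, the map \<open>(q, x) \<mapsto> (M q) x\<close> is bilinear as far as these relators
  can see, so it sends the combination to zero in the second factor itself. All multiples of \<open>D\<close>
  must be allowed, so that two combinations can be treated with a common \<open>M\<close>. The floor
  function makes the map total and is exact on the values that matter.\<close>

lemma cleared_relation:
  fixes w :: "(rat \<times> 'a::ab_group_add) \<Rightarrow>\<^sub>0 int"
  assumes "w \<in> group_closure tensor_relators"
  shows "\<exists>D>0. \<forall>c. free_lift (\<lambda>(q, x). int_scale \<lfloor>of_int (c * D) * q\<rfloor> x) w = 0"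
  using assms
proof induction
  case (base s)
  then consider (zero) "s = 0"
    | (left) p q and x :: 'a where "s = frag_of (p + q, x) - frag_of (p, x) - frag_of (q, x)"
    | (right) q and x y :: 'a where "s = frag_of (q, x + y) - frag_of (q, x) - frag_of (q, y)"
    by (auto simp: tensor_relators_def)
  then show ?case
  proof cases
    case zero
    then show ?thesis by (auto simp: free_lift_def intro: exI[of _ 1])
  next
    case left
    obtain D :: int where D: "D > 0" "\<And>r. r \<in> {p, q} \<Longrightarrow> of_int D * r \<in> \<int>"
      using rat_common_denominator[of "{p, q}" "\<lambda>r. r"] by auto
    have "\<lfloor>of_int (c * D) * (p + q)\<rfloor> = \<lfloor>of_int (c * D) * p\<rfloor> + \<lfloor>of_int (c * D) * q\<rfloor>" for c
    proof -
      have "of_int (c * D) * p \<in> \<int>" using D(2)[of p] by (simp add: mult.assoc)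
      then obtain k where k: "of_int (c * D) * p = of_int k" by (auto elim: Ints_cases)
      show ?thesis unfolding distrib_left k by simp
    qed
    then show ?thesis using D(1)
      by (intro exI[of _ D])
        (simp add: left free_lift_diff int_scale_add_left del: of_int_mult)
  next
    case right
    then show ?thesis
      by (intro exI[of _ 1]) (simp add: free_lift_diff int_scale_add_right)
  qed
next
  case (diff s t)
  obtain D E where D: "D > 0"
      "\<And>c. free_lift (\<lambda>(q, x). int_scale \<lfloor>of_int (c * D) * q\<rfloor> x) s = 0"
    and E: "E > 0" "\<And>c. free_lift (\<lambda>(q, x). int_scale \<lfloor>of_int (c * E) * q\<rfloor> x) t = 0"
    using diff.IH by blast
  show ?case
  proof (intro exI[of _ "D * E"] conjI allI)
    show "D * E > 0" using D(1) E(1) by simp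
    fix c
    show "free_lift (\<lambda>(q, x). int_scale \<lfloor>of_int (c * (D * E)) * q\<rfloor> x) (s - t) = 0"
      unfolding free_lift_diff using D(2)[of "c * E"] E(2)[of "c * D"]
      by (simp add: mult_ac)
  qed
qed

text \<open>If \<open>1 \<otimes> x = 0\<close>, then the generator \<open>(1, x)\<close> is itself a combination of relators, and
  clearing denominators in it leaves \<open>D x = 0\<close>.\<close>

lemma torsion_if_pure_tensor_eq_zero:
  assumes "(1::rat) \<otimes>\<^sub>\<int> x = 0"
  obtains n where "n > 0" "int_scale n x = 0"
proof -
  have "tensor_eq (frag_of (1::rat, x)) 0"
    using assms by (simp add: pure_tensor.abs_eq zero_tensor_def tensor.abs_eq_iff)
  then have "frag_of (1::rat, x) \<in> group_closure tensor_relators"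
    by (simp add: tensor_eq_def)
  from cleared_relation[OF this] obtain D where "D > 0"
      "\<And>c. free_lift (\<lambda>(q, x). int_scale \<lfloor>of_int (c * D) * q\<rfloor> x) (frag_of (1::rat, x)) = 0"
    by blast
  from this(1) this(2)[of 1] show ?thesis using that[of D] by simp
qed

lemma integral_multiple:
  fixes t :: "(rat, 'a::ab_group_add) tensor"
  obtains n x where "n > 0" "rat_scale (of_int n) t = 1 \<otimes>\<^sub>\<int> x"
proof -
  have "\<exists>n x. n > 0 \<and> rat_scale (of_int n) t = 1 \<otimes>\<^sub>\<int> x"
  proof (induction t rule: tensor_induct)
    case zero
    show ?case by (intro exI[of _ 1] exI[of _ 0]) simp
  next
    case (pure q x)
    obtain d :: int where d: "d > 0" "of_int d * q \<in> \<int>" using rat_denominator by blast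
    then obtain k where "of_int d * q = of_int k" by (auto elim: Ints_cases)
    then have "rat_scale (of_int d) (q \<otimes>\<^sub>\<int> x) = 1 \<otimes>\<^sub>\<int> int_scale k x"
      by (simp add: pure_tensor_int_scale_right)
    with d(1) show ?case by blast
  next
    case (diff s t)
    then obtain m n x y where m: "m > 0" "rat_scale (of_int m) s = 1 \<otimes>\<^sub>\<int> x"
      and n: "n > 0" "rat_scale (of_int n) t = 1 \<otimes>\<^sub>\<int> y" by blast
    have "rat_scale (of_int (m * n)) (s - t) =
        rat_scale (of_int n) (rat_scale (of_int m) s) -
        rat_scale (of_int m) (rat_scale (of_int n) t)"
      by (simp add: rat_scale_diff mult.commute)
    also have "\<dots> = 1 \<otimes>\<^sub>\<int> (int_scale n x - int_scale m y)"
      by (simp add: m(2) n(2) pure_tensor_int_scale_right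
          additive.diff[OF biadditive_additive(2)[OF biadditive_pure_tensor]])
    finally show ?case using m(1) n(1) by (metis mult_pos_pos)
  qed
  then show ?thesis using that by blast
qed

text \<open>A maximal independent subset \<open>B\<close> of a finite generating set spans a free subgroup, and
  every generator has a positive multiple in it. A common such multiple \<open>N\<close> maps the whole group
  into this torsion-free subgroup, and so kills all torsion.\<close>

lemma torsion_exponent:
  assumes "finitely_generated (UNIV :: 'v::ab_group_add set)"
  obtains N where "N > 0"
    "\<And>(v::'v) n. n \<noteq> 0 \<Longrightarrow> int_scale n v = 0 \<Longrightarrow> int_scale N v = 0"
proof -
  obtain S :: "'v set" where S: "finite S" "group_closure S = UNIV"
    using assms by (auto simp: finitely_generated_def)
  define F where "F = {B. B \<subseteq> S \<and> int_module.independent B}"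
  have "finite F" using S(1) by (simp add: F_def)
  moreover have "{} \<in> F" by (simp add: F_def int_module.independent_empty)
  ultimately obtain B where B: "B \<in> F" "\<And>C. C \<in> F \<Longrightarrow> B \<subseteq> C \<Longrightarrow> C = B"
    using finite_has_maximal2[of F "{}"] by metis
  have fin: "finite B" and ind: "int_module.independent B"
    using B(1) S(1) by (auto simp: F_def intro: finite_subset)
  have "\<exists>d>0. int_scale d s \<in> int_module.span B" if s: "s \<in> S" for s
  proof (cases "s \<in> B")
    case True
    then show ?thesis by (intro exI[of _ 1]) (simp add: int_module.span_base)
  next
    case False
    then have "int_module.dependent (insert s B)"
      using B(1) B(2)[of "insert s B"] s by (auto simp: F_def)
    then obtain u where u: "\<exists>v\<in>insert s B. u v \<noteq> 0"
      "(\<Sum>v\<in>insert s B. int_scale (u v) v) = 0"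
      using fin by (auto simp: int_module.dependent_finite)
    have sum: "int_scale (u s) s = - (\<Sum>v\<in>B. int_scale (u v) v)"
      using u(2) False fin by (simp add: eq_neg_iff_add_eq_0)
    have "u s \<noteq> 0"
      using u sum int_module.independentD[OF ind fin subset_refl, of u] by auto
    moreover have in_span: "int_scale (u s) s \<in> int_module.span B"
      unfolding sum by (intro int_module.span_neg int_module.span_sum int_module.span_scale)
        (rule int_module.span_base)
    moreover have "int_scale \<bar>u s\<bar> s \<in> int_module.span B"
      using in_span int_module.span_neg[OF in_span]
      by (simp add: abs_if int_scale_minus_left)
    ultimately show ?thesis by (intro exI[of _ "\<bar>u s\<bar>"]) simp
  qed
  moreover have "int_scale (c * d) s \<in> int_module.span B"
    if "int_scale d s \<in> int_module.span B" for s c d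
    using int_module.span_scale[OF that, of c] by (simp add: int_scale_assoc)
  ultimately obtain N where N: "N > 0" "\<forall>s\<in>S. int_scale N s \<in> int_module.span B"
    using int_common_multiple[OF S(1), of "\<lambda>s d. int_scale d s \<in> int_module.span B"] by blast
  have N_span: "int_scale N v \<in> int_module.span B" for v
  proof -
    have "v \<in> group_closure S" using S(2) by simp
    then show ?thesis
      by induction
        (use N(2) in \<open>auto simp: int_module.span_zero int_module.scale_right_diff_distrib
          intro: int_module.span_diff\<close>)
  qed
  have "int_scale N v = 0" if n: "n \<noteq> 0" "int_scale n v = 0" for v :: 'v and n
  proof -
    obtain u where u: "int_scale N v = (\<Sum>b\<in>B. int_scale (u b) b)"
      using N_span[of v] by (auto simp: int_module.span_finite[OF fin])
    have "(\<Sum>b\<in>B. int_scale (n * u b) b) = int_scale n (int_scale N v)"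
      unfolding u by (simp add: int_module.scale_sum_right int_scale_assoc)
    also have "\<dots> = int_scale N (int_scale n v)"
      by (simp add: int_scale_assoc mult.commute)
    finally have "(\<Sum>b\<in>B. int_scale (n * u b) b) = 0" by (simp add: n(2))
    then have "u b = 0" if "b \<in> B" for b
      using int_module.independentD[OF ind fin subset_refl, of "\<lambda>b. n * u b"] that n(1) by simp
    then show ?thesis by (simp add: u)
  qed
  then show ?thesis using that[OF N(1)] by blast
qed

section \<open>Extension of scalars and the rank\<close>

lemma rat_extension_eq_span: "rat_extension H = rat_space.span ((\<otimes>\<^sub>\<int>) 1 ` H)"
proof (rule antisym)
  have pure: "q \<otimes>\<^sub>\<int> x \<in> rat_space.span ((\<otimes>\<^sub>\<int>) 1 ` H)" if "x \<in> H" for q x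
    using rat_space.span_scale[OF rat_space.span_base[of "1 \<otimes>\<^sub>\<int> x" "(\<otimes>\<^sub>\<int>) 1 ` H"], of q] that
    by simp
  have "t \<in> rat_space.span ((\<otimes>\<^sub>\<int>) 1 ` H)" if "t \<in> rat_extension H" for t
    using that unfolding rat_extension_def
    by induction (auto simp: pure rat_space.span_zero rat_space.span_diff)
  then show "rat_extension H \<subseteq> rat_space.span ((\<otimes>\<^sub>\<int>) 1 ` H)" by blast
next
  have "rat_scale c t \<in> rat_extension H" if "t \<in> rat_extension H" for c t
    using that unfolding rat_extension_def
  proof induction
    case (base s)
    have "rat_scale c (q \<otimes>\<^sub>\<int> x) \<in> group_closure {q \<otimes>\<^sub>\<int> x |q x. x \<in> H}" if "x \<in> H" for q x
      using that unfolding rat_scale_pure by (intro group_closure.base) blast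
    with base show ?case by auto
  next
    case (diff s t)
    then show ?case by (simp add: rat_scale_diff group_closure.diff)
  qed
  then have "rat_space.subspace (rat_extension H)"
    unfolding rat_space.subspace_def
    by (simp add: rat_extension_def group_closure_add)
  moreover have "(\<otimes>\<^sub>\<int>) 1 ` H \<subseteq> rat_extension H"
    by (auto simp: rat_extension_def intro: group_closure.base)
  ultimately show "rat_space.span ((\<otimes>\<^sub>\<int>) 1 ` H) \<subseteq> rat_extension H"
    by (rule rat_space.span_minimal[rotated])
qed

lemma subspace_rat_extension: "rat_space.subspace (rat_extension H)"
  by (simp add: rat_extension_eq_span)

lemma pure_tensor_in_rat_extension: "x \<in> H \<Longrightarrow> q \<otimes>\<^sub>\<int> x \<in> rat_extension H"
  by (auto simp: rat_extension_def intro: group_closure.base)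

lemma isotropic_rat_extension:
  assumes "biadditive \<phi>" "isotropic \<phi> H"
  shows "isotropic (rat_form \<phi>) (rat_extension H)"
  unfolding rat_extension_def
  by (rule isotropic_group_closure[OF rat_form_biadditive[OF assms(1)]])
    (use assms(2) in \<open>auto simp: isotropic_def rat_form_pure[OF assms(1)]\<close>)

text \<open>Clearing denominators turns a rational relation among the elements \<open>1 \<otimes> b\<close> into an integral
  relation among the elements \<open>b\<close>, up to torsion, which a further integer factor removes.\<close>

lemma independent_rational_relation:
  assumes "finite B" "int_module.independent B"
    and "(\<Sum>b\<in>B. rat_scale (q b) (1 \<otimes>\<^sub>\<int> b)) = 0" "b \<in> B"
  shows "q b = 0"
proof -
  obtain d :: int where d: "d > 0" "\<And>b. b \<in> B \<Longrightarrow> of_int d * q b \<in> \<int>"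
    using rat_common_denominator[OF assms(1), of q] by blast
  define k where "k b = \<lfloor>of_int d * q b\<rfloor>" for b
  have k: "of_int (k b) = of_int d * q b" if "b \<in> B" for b
    using d(2)[OF that] by (simp add: k_def of_int_floor_cancel)
  have "(1::rat) \<otimes>\<^sub>\<int> (\<Sum>b\<in>B. int_scale (k b) b) = (\<Sum>b\<in>B. of_int (k b) \<otimes>\<^sub>\<int> b)"
    by (simp add: additive.sum[OF biadditive_additive(2)[OF biadditive_pure_tensor]]
        pure_tensor_int_scale_right)
  also have "\<dots> = rat_scale (of_int d) (\<Sum>b\<in>B. rat_scale (q b) (1 \<otimes>\<^sub>\<int> b))"
    by (simp add: rat_space.scale_sum_right k)
  finally have "(1::rat) \<otimes>\<^sub>\<int> (\<Sum>b\<in>B. int_scale (k b) b) = 0"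
    by (simp only: assms(3) rat_scale_zero)
  then obtain n where n: "n > 0" "int_scale n (\<Sum>b\<in>B. int_scale (k b) b) = 0"
    by (rule torsion_if_pure_tensor_eq_zero)
  have "(\<Sum>b\<in>B. int_scale (n * k b) b) = 0"
    using n(2) by (simp add: int_module.scale_sum_right int_scale_assoc)
  then have "n * k b = 0"
    using int_module.independentD[OF assms(2,1) subset_refl, of "\<lambda>b. n * k b"] assms(4) by simp
  then show ?thesis using n(1) d(1) k[OF assms(4)] by simp
qed

lemma independent_image_pure_tensor:
  fixes B :: "'a::ab_group_add set"
  assumes B: "finite B" "int_module.independent B"
  shows "inj_on ((\<otimes>\<^sub>\<int>) (1::rat)) B" and "rat_space.independent ((\<otimes>\<^sub>\<int>) 1 ` B)"
proof -
  show inj: "inj_on ((\<otimes>\<^sub>\<int>) (1::rat)) B"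
  proof (rule inj_onI, rule ccontr)
    fix a b assume ab: "a \<in> B" "b \<in> B" "(1::rat) \<otimes>\<^sub>\<int> a = 1 \<otimes>\<^sub>\<int> b" "a \<noteq> b"
    let ?q = "\<lambda>x. if x = a then 1 else if x = b then - 1 else (0::rat)"
    have "(\<Sum>x\<in>B. rat_scale (?q x) (1 \<otimes>\<^sub>\<int> x)) = (\<Sum>x\<in>{a, b}. rat_scale (?q x) (1 \<otimes>\<^sub>\<int> x))"
      using ab B(1) by (intro sum.mono_neutral_right) auto
    also have "\<dots> = rat_scale 1 (1 \<otimes>\<^sub>\<int> a) + rat_scale (- 1) (1 \<otimes>\<^sub>\<int> b)"
      using ab(4) by simp
    also have "\<dots> = 0" unfolding ab(3) rat_space.scale_left_distrib[symmetric] by simp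
    finally show False using independent_rational_relation[OF B _ ab(1), of ?q] by simp
  qed
  show "rat_space.independent ((\<otimes>\<^sub>\<int>) 1 ` B)"
  proof (rule rat_space.independent_if_scalars_zero)
    fix q and t :: "(rat, 'a) tensor"
    assume q: "(\<Sum>t\<in>(\<otimes>\<^sub>\<int>) 1 ` B. rat_scale (q t) t) = 0" and "t \<in> (\<otimes>\<^sub>\<int>) 1 ` B"
    then obtain b where b: "b \<in> B" "t = 1 \<otimes>\<^sub>\<int> b" by blast
    have "(\<Sum>b\<in>B. rat_scale (q (1 \<otimes>\<^sub>\<int> b)) (1 \<otimes>\<^sub>\<int> b)) = 0"
      using q by (simp add: sum.reindex[OF inj] del: rat_scale_pure)
    from independent_rational_relation[OF B this b(1)] show "q t = 0" by (simp add: b(2))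
  qed (use B in simp)
qed

lemma independent_if_image_pure_tensor:
  assumes "finite B" "inj_on ((\<otimes>\<^sub>\<int>) (1::rat)) B" "rat_space.independent ((\<otimes>\<^sub>\<int>) 1 ` B)"
  shows "int_module.independent B"
proof
  assume "int_module.dependent B"
  then obtain u b where u: "b \<in> B" "u b \<noteq> 0" "(\<Sum>b\<in>B. int_scale (u b) b) = 0"
    using assms(1) by (auto simp: int_module.dependent_finite)
  define q where "q t = rat_of_int (u (the_inv_into B ((\<otimes>\<^sub>\<int>) (1::rat)) t))" for t
  have q: "q (1 \<otimes>\<^sub>\<int> b) = of_int (u b)" if "b \<in> B" for b
    using that by (simp add: q_def the_inv_into_f_f[OF assms(2)])
  have "(\<Sum>t\<in>(\<otimes>\<^sub>\<int>) 1 ` B. rat_scale (q t) t) = (\<Sum>b\<in>B. of_int (u b) \<otimes>\<^sub>\<int> b)"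
    by (simp add: sum.reindex[OF assms(2)] q)
  also have "\<dots> = 1 \<otimes>\<^sub>\<int> (\<Sum>b\<in>B. int_scale (u b) b)"
    by (simp add: additive.sum[OF biadditive_additive(2)[OF biadditive_pure_tensor]]
        pure_tensor_int_scale_right)
  finally have "(\<Sum>t\<in>(\<otimes>\<^sub>\<int>) 1 ` B. rat_scale (q t) t) = 0" by (simp add: u(3))
  then have "q (1 \<otimes>\<^sub>\<int> b) = 0"
    using rat_space.independentD[OF assms(3) _ subset_refl, of q] assms(1) u(1) by simp
  then show False using q[OF u(1)] u(2) by simp
qed

lemma finite_dimensional:
  assumes "finitely_generated (UNIV :: 'l::ab_group_add set)"
  obtains T :: "(rat, 'l::ab_group_add) tensor set" where "finite T" "rat_space.span T = UNIV"
proof -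
  obtain S :: "'l set" where S: "finite S" "group_closure S = UNIV"
    using assms by (auto simp: finitely_generated_def)
  let ?T = "(\<otimes>\<^sub>\<int>) (1::rat) ` S"
  have 1: "1 \<otimes>\<^sub>\<int> x \<in> rat_space.span ?T" for x
  proof -
    have "x \<in> group_closure S" using S(2) by simp
    then show ?thesis
    proof induction
      case (base s)
      then show ?case by (auto simp: rat_space.span_zero intro: rat_space.span_base)
    next
      case (diff s t)
      then show ?case
        by (simp add: additive.diff[OF biadditive_additive(2)[OF biadditive_pure_tensor]]
            rat_space.span_diff)
    qed
  qed
  have "t \<in> rat_space.span ?T" for t
  proof (induction t rule: tensor_induct)
    case (pure q x)
    then show ?case using rat_space.span_scale[OF 1, of q x] by simp
  qed (simp_all add: rat_space.span_zero rat_space.span_diff)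
  then show ?thesis using that[of ?T] S(1) by blast
qed

text \<open>The extension of \<open>H\<close> has a basis of vectors \<open>1 \<otimes> b\<close> with \<open>b \<in> H\<close>, and the elements \<open>b\<close>
  form an independent subset of \<open>H\<close>. No independent subset of \<open>H\<close> is larger, since its image is
  independent in the extension.\<close>

lemma group_rank_eq_dim:
  fixes H :: "'l::ab_group_add set"
  assumes "finitely_generated (UNIV :: 'l set)"
  shows "group_rank H = rat_space.dim (rat_extension H)"
proof -
  let ?e = "(\<otimes>\<^sub>\<int>) (1::rat) :: 'l \<Rightarrow> (rat, 'l) tensor"
  let ?R = "{card B |B. finite B \<and> B \<subseteq> H \<and> int_module.independent B}"
  obtain T :: "(rat, 'l) tensor set" where T: "finite T" "rat_space.span T = UNIV"
    using finite_dimensional[OF assms] .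
  obtain C where C: "C \<subseteq> ?e ` H" "rat_space.independent C" "?e ` H \<subseteq> rat_space.span C"
    using rat_space.maximal_independent_subset .
  have finC: "finite C"
    using rat_space.independent_span_bound[OF T(1) C(2)] T(2) by simp
  have span: "rat_extension H = rat_space.span C"
    unfolding rat_extension_eq_span
    by (rule antisym[OF rat_space.span_minimal rat_space.span_mono])
      (use C in simp_all)
  have dim: "rat_space.dim (rat_extension H) = card C"
    unfolding span by (rule rat_space.dim_span_eq_card_independent[OF C(2)])
  obtain B where B: "B \<subseteq> H" "inj_on ?e B" "?e ` B = C"
    using subset_image_inj[THEN iffD1, OF C(1)] by auto
  have finB: "finite B" using B finC by (metis finite_imageD)
  have "card C \<in> ?R"
    using B finB C(2) independent_if_image_pure_tensor[OF finB B(2)] card_image[OF B(2)]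
    by (auto intro!: exI[of _ B])
  moreover have "r \<le> card C" if r: "r \<in> ?R" for r
  proof -
    obtain A where A: "r = card A" "finite A" "A \<subseteq> H" "int_module.independent A"
      using r by blast
    note img = independent_image_pure_tensor[OF A(2,4)]
    have "?e ` A \<subseteq> rat_space.span C" using A(3) C(3) by blast
    then have "card (?e ` A) \<le> card C"
      using rat_space.independent_span_bound[OF finC img(2)] by simp
    then show ?thesis by (simp add: A(1) card_image[OF img(1)])
  qed
  moreover from this have "finite ?R" by (meson finite_nat_set_iff_bounded_le)
  ultimately show ?thesis unfolding group_rank_def dim by (intro Max_eqI) auto
qed

section \<open>Maximal isotropic subgroups and subspaces\<close>

lemma ex_max_isotropic_subgroup:
  assumes "is_subgroup G" "isotropic \<phi> G"
  obtains H where "max_isotropic_subgroup \<phi> H" "G \<subseteq> H"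
proof -
  let ?A = "{K. is_subgroup K \<and> isotropic \<phi> K \<and> G \<subseteq> K}"
  have "\<exists>M\<in>?A. \<forall>X\<in>?A. M \<subseteq> X \<longrightarrow> X = M"
  proof (rule subset_Zorn_nonempty)
    show "?A \<noteq> {}" using assms by blast
  next
    fix C assume C: "C \<noteq> {}" "subset.chain ?A C"
    then have sub: "\<And>K. K \<in> C \<Longrightarrow> is_subgroup K \<and> isotropic \<phi> K \<and> G \<subseteq> K"
      by (auto simp: subset.chain_def)
    have common: "\<exists>K\<in>C. x \<in> K \<and> y \<in> K" if xy: "x \<in> \<Union>C" "y \<in> \<Union>C" for x y
    proof -
      obtain K K' where K: "K \<in> C" "x \<in> K" "K' \<in> C" "y \<in> K'" using xy by blast
      then have "K \<subseteq> K' \<or> K' \<subseteq> K" using C(2) by (auto simp: subset_chain_def)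
      then show ?thesis using K by blast
    qed
    have "is_subgroup (\<Union>C)"
      unfolding is_subgroup_def
    proof (intro conjI ballI)
      show "0 \<in> \<Union>C" using C(1) sub by (auto simp: is_subgroup_def)
    next
      fix x y assume "x \<in> \<Union>C" "y \<in> \<Union>C"
      then show "x + y \<in> \<Union>C" using common[of x y] sub unfolding is_subgroup_def by blast
    next
      fix x assume "x \<in> \<Union>C"
      then show "- x \<in> \<Union>C" using sub unfolding is_subgroup_def by blast
    qed
    moreover have "isotropic \<phi> (\<Union>C)"
      unfolding isotropic_def using common sub unfolding isotropic_def by meson
    ultimately show "\<Union>C \<in> ?A" using C(1) sub by blast
  qed
  then obtain M where "M \<in> ?A" "\<forall>X\<in>?A. M \<subseteq> X \<longrightarrow> X = M" by blast
  then have "max_isotropic_subgroup \<phi> M" "G \<subseteq> M"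
    unfolding max_isotropic_subgroup_def by blast+
  then show ?thesis by (rule that)
qed

text \<open>The value \<open>\<phi>(x, y)\<close> is torsion if \<open>1 \<otimes> x\<close> and \<open>1 \<otimes> y\<close> are orthogonal, so the exponent \<open>N\<close>
  of the torsion of \<open>V\<close> kills it.\<close>

lemma exponent_kills_orthogonal:
  fixes \<phi> :: "'l::ab_group_add \<Rightarrow> 'l \<Rightarrow> 'v::ab_group_add"
  assumes "biadditive \<phi>"
    and N: "\<And>(v::'v) n. n \<noteq> 0 \<Longrightarrow> int_scale n v = 0 \<Longrightarrow> int_scale N v = 0"
    and "rat_form \<phi> (1 \<otimes>\<^sub>\<int> x) (1 \<otimes>\<^sub>\<int> y) = 0"
  shows "\<phi> (int_scale N x) y = 0" "\<phi> x (int_scale N y) = 0"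
proof -
  have "(1::rat) \<otimes>\<^sub>\<int> \<phi> x y = 0" using assms(3) by (simp add: rat_form_pure[OF assms(1)])
  then obtain n where "n > 0" "int_scale n (\<phi> x y) = 0"
    by (rule torsion_if_pure_tensor_eq_zero)
  then have "int_scale N (\<phi> x y) = 0" using N[of n] by simp
  then show "\<phi> (int_scale N x) y = 0" "\<phi> x (int_scale N y) = 0"
    by (simp_all add: biadditive_int_scale[OF assms(1)])
qed

lemma max_isotropic_rat_extension:
  fixes \<phi> :: "'l::ab_group_add \<Rightarrow> 'l \<Rightarrow> 'v::ab_group_add"
  assumes V: "finitely_generated (UNIV :: 'v set)" and \<phi>: "biadditive \<phi>"
    and H: "max_isotropic_subgroup \<phi> H"
  shows "max_isotropic_subspace (rat_form \<phi>) (rat_extension H)"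
proof -
  obtain N where N: "N > 0"
    "\<And>(v::'v) n. n \<noteq> 0 \<Longrightarrow> int_scale n v = 0 \<Longrightarrow> int_scale N v = 0"
    using torsion_exponent[OF V] by metis
  have iso: "isotropic \<phi> H" using H by (simp add: max_isotropic_subgroup_def)
  have "U \<subseteq> rat_extension H"
    if U: "rat_space.subspace U" "isotropic (rat_form \<phi>) U" "rat_extension H \<subseteq> U" for U
  proof
    fix t assume t: "t \<in> U"
    obtain n x where n: "n > 0" "rat_scale (of_int n) t = 1 \<otimes>\<^sub>\<int> x" by (rule integral_multiple)
    have x: "1 \<otimes>\<^sub>\<int> x \<in> U" using rat_space.subspace_scale[OF U(1) t] n(2) by metis
    let ?K = "insert (int_scale N x) H"
    \<comment> \<open>The case \<open>y = x\<close> is what makes the new generator orthogonal to itself.\<close>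
    have zero: "\<phi> (int_scale N x) y = 0 \<and> \<phi> y (int_scale N x) = 0"
      if y: "y = x \<or> y \<in> H" for y
    proof -
      have "1 \<otimes>\<^sub>\<int> y \<in> U" using y x U(3) pure_tensor_in_rat_extension[of y H 1] by blast
      then have "rat_form \<phi> (1 \<otimes>\<^sub>\<int> x) (1 \<otimes>\<^sub>\<int> y) = 0" "rat_form \<phi> (1 \<otimes>\<^sub>\<int> y) (1 \<otimes>\<^sub>\<int> x) = 0"
        using x U(2) by (simp_all only: isotropic_def)
      then show ?thesis using exponent_kills_orthogonal[OF \<phi> N(2)] by simp
    qed
    have "isotropic \<phi> ?K"
      using iso zero biadditive_int_scale(2)[OF \<phi>, of "int_scale N x" N x]
      by (auto simp: isotropic_def)
    then have "isotropic \<phi> (group_closure ?K)" by (rule isotropic_group_closure[OF \<phi>])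
    then have "group_closure ?K = H"
      using H group_closure_superset[of ?K] is_subgroup_group_closure[of ?K]
      unfolding max_isotropic_subgroup_def by (metis insert_subset psubsetI)
    then have Nx: "int_scale N x \<in> H" using group_closure_superset[of ?K] by auto
    have "t = rat_scale (1 / of_int n) (rat_scale (of_int n) t)" using n(1) by simp
    also have "\<dots> = (1 / (of_int n * of_int N)) \<otimes>\<^sub>\<int> int_scale N x"
      unfolding n(2) using N(1) by (simp add: pure_tensor_int_scale_right)
    finally show "t \<in> rat_extension H" using pure_tensor_in_rat_extension[OF Nx] by simp
  qed
  then show ?thesis
    using subspace_rat_extension isotropic_rat_extension[OF \<phi> iso]
    unfolding max_isotropic_subspace_def by blast
qed

lemma max_isotropic_subspace_is_rat_extension:
  fixes \<phi> :: "'l::ab_group_add \<Rightarrow> 'l \<Rightarrow> 'v::ab_group_add"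
  assumes V: "finitely_generated (UNIV :: 'v set)" and \<phi>: "biadditive \<phi>"
    and W: "max_isotropic_subspace (rat_form \<phi>) W"
  obtains H where "max_isotropic_subgroup \<phi> H" "W = rat_extension H"
proof -
  obtain N where N: "N > 0"
    "\<And>(v::'v) n. n \<noteq> 0 \<Longrightarrow> int_scale n v = 0 \<Longrightarrow> int_scale N v = 0"
    using torsion_exponent[OF V] by metis
  have sub: "rat_space.subspace W" and iso: "isotropic (rat_form \<phi>) W"
    using W by (simp_all add: max_isotropic_subspace_def)
  let ?G = "{int_scale N x |x. 1 \<otimes>\<^sub>\<int> x \<in> W}"
  have "\<phi> (int_scale N x) (int_scale N y) = 0" if "1 \<otimes>\<^sub>\<int> x \<in> W" "1 \<otimes>\<^sub>\<int> y \<in> W" for x y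
    using exponent_kills_orthogonal(1)[where x = x and y = y, OF \<phi> N(2)] that iso
    by (simp add: isotropic_def biadditive_int_scale(2)[OF \<phi>])
  then have "isotropic \<phi> ?G" by (auto simp: isotropic_def)
  from ex_max_isotropic_subgroup[OF is_subgroup_group_closure isotropic_group_closure[OF \<phi> this]]
  obtain H where H: "max_isotropic_subgroup \<phi> H" "group_closure ?G \<subseteq> H" .
  have "W \<subseteq> rat_extension H"
  proof
    fix t assume t: "t \<in> W"
    obtain n x where n: "n > 0" "rat_scale (of_int n) t = 1 \<otimes>\<^sub>\<int> x" by (rule integral_multiple)
    have "1 \<otimes>\<^sub>\<int> x \<in> W" using rat_space.subspace_scale[OF sub t] n(2) by metis
    then have Nx: "int_scale N x \<in> H" using H(2) group_closure_superset[of ?G] by blast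
    have "t = rat_scale (1 / of_int n) (rat_scale (of_int n) t)" using n(1) by simp
    also have "\<dots> = (1 / (of_int n * of_int N)) \<otimes>\<^sub>\<int> int_scale N x"
      unfolding n(2) using N(1) by (simp add: pure_tensor_int_scale_right)
    finally show "t \<in> rat_extension H" using pure_tensor_in_rat_extension[OF Nx] by simp
  qed
  moreover have "isotropic (rat_form \<phi>) (rat_extension H)"
    using H(1) isotropic_rat_extension[OF \<phi>] by (simp add: max_isotropic_subgroup_def)
  ultimately have "W = rat_extension H"
    using W subspace_rat_extension unfolding max_isotropic_subspace_def by blast
  then show ?thesis using that H(1) by blast
qed

theorem lemma7:
  fixes \<phi> :: "'l::ab_group_add \<Rightarrow> 'l \<Rightarrow> 'v::ab_group_add"
  assumes "finitely_generated (UNIV :: 'l set)"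
    and "finitely_generated (UNIV :: 'v set)"
    and "biadditive \<phi>"
    and "skew_symmetric \<phi>"
  shows "(\<forall>H. max_isotropic_subgroup \<phi> H \<longrightarrow>
            max_isotropic_subspace (rat_form \<phi>) (rat_extension H))
       \<and> (\<forall>W. max_isotropic_subspace (rat_form \<phi>) W \<longrightarrow>
            (\<exists>H. max_isotropic_subgroup \<phi> H \<and> W = rat_extension H))
       \<and> isotropic_ranks \<phi> = isotropic_dims (rat_form \<phi>)
       \<and> max_isotropic_rank \<phi> = max_isotropic_dim (rat_form \<phi>)"
proof -
  have i: "max_isotropic_subspace (rat_form \<phi>) (rat_extension H)"
    if "max_isotropic_subgroup \<phi> H" for H
    using max_isotropic_rat_extension[OF assms(2,3) that] .
  have ii: "\<exists>H. max_isotropic_subgroup \<phi> H \<and> W = rat_extension H"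
    if "max_isotropic_subspace (rat_form \<phi>) W" for W
    using max_isotropic_subspace_is_rat_extension[OF assms(2,3) that] by blast
  have "isotropic_ranks \<phi> = isotropic_dims (rat_form \<phi>)"
    unfolding isotropic_ranks_def isotropic_dims_def group_rank_eq_dim[OF assms(1)]
    using i ii by blast
  then show ?thesis
    using i ii by (simp add: max_isotropic_rank_def max_isotropic_dim_def)
qed

end
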